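(* Let $G_1$ be a Polish group admitting an invariant metric and let $G_2$ be a locally compact Polish group. Let $f:G_1\to G_2$ be a continuous mapping (not necessarily a homomorphism). If $X\subseteq G_1$ is $\mathcal M$-additive in $G_1$, then $f(X)$ is $\mathcal M$-additive in $G_2$.
   Context: A Polish group is a topological group whose topology is separable and completely metrizable. An invariant metric is a metric compatible with the topology that is both left- and right-invariant. A set is meager if it is a countable union of nowhere dense sets. For a Polish group $G$, a set $X\subseteq G$ is $\mathcal M$-additive (meager-additive) if $MX=\{mx:m\in M,x\in X\}$ is meager for every meager set $M\subseteq G$. *)

theory Defs
  imports "HOL-Analysis.Analysis"
begin

text \<open>
  Polish groups are rendered as types of sort \<open>{topological_group_add, polish_space}\<close>.
  The group operation of \<^class>\<open>topological_group_add\<close> is written additively, but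
  it is not assumed to be commutative.  The metric \<^const>\<open>dist\<close> carried by
  \<^class>\<open>polish_space\<close> is just some complete metric inducing the topology, unrelated
  to the group structure; an invariant metric is in general a different one, and it
  is not required to be complete.
\<close>

definition invariant_metric :: "('a::topological_group_add \<Rightarrow> 'a \<Rightarrow> real) \<Rightarrow> bool" where
  "invariant_metric d \<longleftrightarrow>
     Metric_space UNIV d \<and>
     Metric_space.mtopology UNIV d = euclidean \<and>
     (\<forall>a x y. d (a + x) (a + y) = d x y) \<and>
     (\<forall>a x y. d (x + a) (y + a) = d x y)"

definition nowhere_dense :: "'a::topological_space set \<Rightarrow> bool" where
  "nowhere_dense N \<longleftrightarrow> interior (closure N) = {}"

definition meager :: "'a::topological_space set \<Rightarrow> bool" where
  "meager M \<longleftrightarrow> (\<exists>\<N>. countable \<N> \<and> (\<forall>N\<in>\<N>. nowhere_dense N) \<and> M = \<Union>\<N>)"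

definition meager_additive :: "'a::topological_group_add set \<Rightarrow> bool" where
  "meager_additive X \<longleftrightarrow> (\<forall>M. meager M \<longrightarrow> meager {m + x |m x. m \<in> M \<and> x \<in> X})"

end

theory Submission
  imports Defs
begin

text \<open>
  The property that passes from the meager-additive set \<open>X\<close> to its image is
  sharp measure zero: for every prescribed sequence of radii \<open>\<epsilon> j\<close> one can place few balls of
  radius \<open>\<epsilon> j\<close> at each stage \<open>j\<close>, so that every point of \<open>X\<close> is caught between the
  stages \<open>n\<close> and \<open>g n\<close> for all but finitely many \<open>n\<close>.

  Meager-additive sets have sharp measure zero
  (\<open>meager_additive_imp_sharp_measure_zero\<close>).  Fix steps \<open>v n\<close> whose lengths \<open>w n\<close> decrease
  very fast, and a dense sequence \<open>p\<close>.  The set \<open>M\<close> of points whose distance to every \<open>p j\<close>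
  is at least \<open>w j / 4\<close> is closed and nowhere dense, so \<open>M + X\<close> is covered by an
  increasing sequence of closed nowhere dense sets \<open>H n\<close>.  For a given \<open>x\<close>, a point of
  \<open>M + x\<close> can be built by a walk which at time \<open>j\<close> adds or omits \<open>v j\<close>, whichever stays
  away from \<open>p j + x\<close>.  All walks together visit only finitely many points by time \<open>n\<close>, in a
  number bounded independently of everything else.  Hence it is possible to fix in advance, for
  each point reached by time \<open>n\<close>, a nearby point \<open>J n a\<close> with a neighbourhood disjoint
  from \<open>H n\<close>, and a time \<open>g n\<close> from which on a walk moves too little to leave these neighbourhoods.
  A walk may jump to \<open>J n a\<close> and rest there until time \<open>g n\<close>, unless one of the points
  \<open>p j + x\<close> with \<open>n \<le> j < g n\<close> is too close; by invariance of the metric, that exception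
  says that \<open>x\<close> is close to \<open>- p j + J n a\<close>.  If the exception failed to occur for
  infinitely many \<open>n\<close>, the walk with these jumps would end at a point of \<open>M + x\<close> outside all
  \<open>H n\<close>.  So the points \<open>- p j + J n a\<close> witness sharp measure zero.

  The walks converge because a two-sided invariant metric of a Polish group is complete
  (\<open>invariant_metric_complete\<close>).  Completeness also shows that a set of sharp measure
  zero, being covered by countably many totally bounded sets, lies in a countable union of
  compact sets (\<open>sharp_measure_zero_imp_sigma_compact\<close>); there mere continuity of \<open>f\<close> has
  the strength of uniform continuity.

  For the return to category (\<open>sharp_measure_zero_imp_meager_additive_image\<close>), let \<open>F\<close> be
  closed and nowhere dense.  Every open set \<open>W\<close> contains a smaller one disjoint from
  \<open>F + f y\<close>, and the same one works for all \<open>y\<close> near a given point.  On a compact set this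
  becomes uniform: there are a radius \<open>e\<close> and finitely many open subsets of \<open>W\<close>, such that for
  each ball of radius \<open>e\<close> one of the subsets avoids \<open>F + f y\<close> for all \<open>y\<close> in the
  ball.  Iterating over stages \<open>j\<close> with radii \<open>\<epsilon> j\<close>, a basic open set can be shrunk from
  stage \<open>n\<close> to stage \<open>g n\<close> so as to avoid everything that is caught in between.  This makes
  the relevant parts of \<open>M + f ` X\<close> nowhere dense.
\<close>

section \<open>Sharp measure zero\<close>

text \<open>
  The classical definition uses one set of diameter at most \<open>\<epsilon> j\<close> for each index \<open>j\<close>, and
  groups the indices into consecutive finite blocks.  Allowing \<open>3 ^ Suc j\<close> balls at stage
  \<open>j\<close> gives the same notion, since \<open>\<epsilon>\<close> may be chosen with this bound in view; the bound
  is the number of nodes of a ternary tree at level \<open>Suc j\<close>, the form in which the balls arise.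
\<close>

definition sharp_measure_zero :: "('a \<Rightarrow> 'a \<Rightarrow> real) \<Rightarrow> 'a set \<Rightarrow> bool" where
  "sharp_measure_zero d X \<longleftrightarrow>
     (\<forall>\<epsilon>::nat \<Rightarrow> real. (\<forall>j. 0 < \<epsilon> j) \<longrightarrow>
       (\<exists>E g. (\<forall>j. finite (E j) \<and> card (E j) \<le> 3 ^ Suc j) \<and>
              (\<forall>x\<in>X. \<forall>\<^sub>F n in sequentially. \<exists>j\<in>{n..<g n}. \<exists>u\<in>E j. d x u < \<epsilon> j)))"

lemma sharp_measure_zero_countable:
  assumes "countable X" and "\<And>x. d x x = 0"
  shows "sharp_measure_zero d X"
  unfolding sharp_measure_zero_def
proof (intro allI impI)
  fix \<epsilon> :: "nat \<Rightarrow> real" assume \<epsilon>: "\<forall>j. 0 < \<epsilon> j"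
  define E where "E j = from_nat_into X ` {..j}" for j
  have "\<forall>\<^sub>F n in sequentially. \<exists>j\<in>{n..<Suc n}. \<exists>u\<in>E j. d x u < \<epsilon> j" if x: "x \<in> X" for x
  proof -
    obtain i where "from_nat_into X i = x"
      using from_nat_into_surj[OF assms(1) x] by blast
    then have "x \<in> E n" if "n \<ge> i" for n using that by (auto simp: E_def)
    then have "\<exists>j\<in>{n..<Suc n}. \<exists>u\<in>E j. d x u < \<epsilon> j" if "n \<ge> i" for n
      using that \<epsilon> assms(2) by (metis atLeastLessThan_iff lessI order_refl)
    then show ?thesis unfolding eventually_sequentially by blast
  qed
  moreover have "finite (E j) \<and> card (E j) \<le> 3 ^ Suc j" for j
  proof -
    have "card (E j) \<le> Suc j"
      unfolding E_def using card_image_le[of "{..j}" "from_nat_into X"] by simp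
    also have "\<dots> \<le> 3 ^ Suc j"
      by (induction j) auto
    finally show ?thesis by (simp add: E_def)
  qed
  ultimately show "\<exists>E g. (\<forall>j. finite (E j) \<and> card (E j) \<le> 3 ^ Suc j) \<and>
      (\<forall>x\<in>X. \<forall>\<^sub>F n in sequentially. \<exists>j\<in>{n..<g n}. \<exists>u\<in>E j. d x u < \<epsilon> j)"
    by (intro exI[of _ E] exI[of _ Suc]) blast
qed

section \<open>Meager sets\<close>

lemma interior_Un_closed_empty:
  assumes "finite I" "\<And>i. i \<in> I \<Longrightarrow> closed (C i)" "\<And>i. i \<in> I \<Longrightarrow> interior (C i) = {}"
  shows "interior (\<Union>i\<in>I. C i) = {}"
  using assms by (induction I) (simp_all add: interior_closed_Un_empty_interior)

lemma meager_increasing_closed_cover: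
  assumes "meager M"
  obtains H :: "nat \<Rightarrow> 'a::topological_space set"
    where "\<And>n. closed (H n)" "\<And>n. interior (H n) = {}" "incseq H" "M \<subseteq> (\<Union>n. H n)"
proof -
  obtain \<N> where \<N>: "countable \<N>" "\<And>N. N \<in> \<N> \<Longrightarrow> nowhere_dense N" "M = \<Union>\<N>"
    using assms unfolding meager_def by blast
  define C where "C k = closure (from_nat_into (insert {} \<N>) k)" for k
  have C: "closed (C k)" "interior (C k) = {}" for k
    using \<N>(2) from_nat_into[of "insert {} \<N>" k] by (auto simp: C_def nowhere_dense_def)
  define H where "H n = (\<Union>k\<le>n. C k)" for n
  show thesis
  proof
    show "closed (H n)" for n using C by (auto simp: H_def)
    show "interior (H n) = {}" for n
      unfolding H_def by (intro interior_Un_closed_empty C finite_atMost)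
    show "incseq H" unfolding H_def by (intro monoI) force
    show "M \<subseteq> (\<Union>n. H n)"
    proof
      fix x assume "x \<in> M"
      then obtain N where N: "N \<in> \<N>" "x \<in> N" using \<N>(3) by blast
      obtain k where "from_nat_into (insert {} \<N>) k = N"
        using from_nat_into_surj[of "insert {} \<N>" N] \<N>(1) N(1) by auto
      then have "x \<in> H k" using N(2) closure_subset by (auto simp: H_def C_def)
      then show "x \<in> (\<Union>n. H n)" by blast
    qed
  qed
qed

lemma nowhere_dense_if_avoidable:
  assumes "\<And>W. open W \<Longrightarrow> W \<noteq> {} \<Longrightarrow> \<exists>V. open V \<and> V \<noteq> {} \<and> V \<subseteq> W \<and> V \<inter> N = {}"
  shows "nowhere_dense N"
  unfolding nowhere_dense_def
proof (rule ccontr)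
  assume "interior (closure N) \<noteq> {}"
  then obtain V where V: "open V" "V \<noteq> {}" "V \<subseteq> interior (closure N)" "V \<inter> N = {}"
    using assms[of "interior (closure N)"] by auto
  then have "V \<inter> closure N = {}" by (simp add: open_Int_closure_eq_empty)
  then show False using V interior_subset by blast
qed

lemma meager_subset_countable_Union:
  assumes "\<And>n::nat. nowhere_dense (N n)" "A \<subseteq> (\<Union>n. N n)"
  shows "meager A"
  unfolding meager_def
proof (intro exI conjI ballI)
  show "countable (range (\<lambda>n. A \<inter> N n))" by simp
  show "A = \<Union>(range (\<lambda>n. A \<inter> N n))" using assms(2) by auto
  fix B assume "B \<in> range (\<lambda>n. A \<inter> N n)"
  then obtain n where "B \<subseteq> N n" by auto
  then show "nowhere_dense B"
    using assms(1)[of n] interior_mono[OF closure_mono] unfolding nowhere_dense_def by blast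
qed

section \<open>Polish groups with an invariant metric\<close>

locale invariant_metric_group =
  fixes d :: "'a::{topological_group_add, polish_space} \<Rightarrow> 'a \<Rightarrow> real"
  assumes invariant: "invariant_metric d"
begin

sublocale Metric_space UNIV d
  using invariant by (simp add: invariant_metric_def)

lemma mtopology_eq [simp]: "mtopology = euclidean"
  using invariant by (simp add: invariant_metric_def)

lemma left_invariant [simp]: "d (a + x) (a + y) = d x y"
  using invariant by (simp add: invariant_metric_def)

lemma right_invariant [simp]: "d (x + a) (y + a) = d x y"
  using invariant by (simp add: invariant_metric_def)

lemma open_iff: "open S \<longleftrightarrow> (\<forall>x\<in>S. \<exists>r>0. \<forall>y. d x y < r \<longrightarrow> y \<in> S)"
  using openin_mtopology[of S] by (simp add: subset_eq Ball_def)

lemma open_metric_ball: "open {y. d x y < r}"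
  using openin_mball[of x r] by (simp add: mball_def)

text \<open>
  A classical theorem of Klee.  Let \<open>x\<close> be Cauchy for \<open>d\<close>.  It is enough to find
  \<open>g\<close> such that \<open>x n + g\<close> is Cauchy for the complete metric \<^const>\<open>dist\<close>.  The condition that the
  tails of \<open>x n + g\<close> become small for \<^const>\<open>dist\<close> up to a fixed error is open in \<open>g\<close>.  It is
  also dense: for every \<open>h\<close> it holds at \<open>- x N' + h\<close> with \<open>N'\<close> large, as
  \<open>x n - x N' + h\<close> is then close to \<open>h\<close>; taking \<open>h = x N + g0\<close> puts this element
  close to \<open>g0\<close>.  So the Baire category theorem yields \<open>g\<close>.
\<close>
lemma invariant_metric_complete: "mcomplete"
  unfolding mcomplete_def
proof (intro allI impI)
  fix x assume x: "MCauchy x"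
  define D where "D k = {g. \<exists>r>0. \<exists>N. \<forall>n\<ge>N. \<forall>m\<ge>N. \<forall>a b.
      d (x n + g) a < r \<longrightarrow> d (x m + g) b < r \<longrightarrow> dist a b < inverse (real (Suc k))}" for k
  have D: "open (D k) \<and> closure (D k) = UNIV" for k
  proof
    show "open (D k)"
      unfolding open_iff
    proof
      fix g assume "g \<in> D k"
      then obtain r N where r: "r > 0" and N: "\<And>n m a b. n \<ge> N \<Longrightarrow> m \<ge> N \<Longrightarrow>
          d (x n + g) a < r \<Longrightarrow> d (x m + g) b < r \<Longrightarrow> dist a b < inverse (real (Suc k))"
        unfolding D_def by blast
      have "h \<in> D k" if h: "d g h < r/2" for h
      proof -
        have "d (x n + g) a < r" if "d (x n + h) a < r/2" for n a
          using that h triangle[of "x n + g" "x n + h" a] by simp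
        then show ?thesis unfolding D_def using N r
          by (intro CollectI exI[of _ "r/2"]) (auto intro!: exI[of _ N])
      qed
      then show "\<exists>r>0. \<forall>y. d g y < r \<longrightarrow> y \<in> D k"
        using r by (intro exI[of _ "r/2"]) auto
    qed
  next
    have "\<exists>g\<in>D k. g \<in> U" if U: "open U" "g0 \<in> U" for U g0
    proof -
      obtain \<delta> where \<delta>: "\<delta> > 0" "\<And>y. d g0 y < \<delta> \<Longrightarrow> y \<in> U"
        using U unfolding open_iff by blast
      obtain N where N: "\<And>n m. n \<ge> N \<Longrightarrow> m \<ge> N \<Longrightarrow> d (x n) (x m) < \<delta>"
        using x \<delta>(1) unfolding MCauchy_def by blast
      define h where "h = x N + g0"
      have "open (ball h (inverse (2 * real (Suc k))))" by simp
      then obtain s where s: "s > 0" "\<And>y. d h y < s \<Longrightarrow> dist h y < inverse (2 * real (Suc k))"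
        unfolding open_iff[of "ball h (inverse (2 * real (Suc k)))"]
        by (metis centre_in_ball inverse_positive_iff_positive mem_ball of_nat_0_less_iff
            zero_less_Suc zero_less_mult_iff zero_less_numeral)
      obtain N1 where N1: "\<And>n m. n \<ge> N1 \<Longrightarrow> m \<ge> N1 \<Longrightarrow> d (x n) (x m) < s/2"
        using x s(1) unfolding MCauchy_def by (meson half_gt_zero)
      define N' where "N' = max N N1"
      define g where "g = - x N' + h"
      have close: "d h a < s" if "n \<ge> N'" "d (x n + g) a < s/2" for n a
      proof -
        have "d (x n + g) h = d (x n + (- x N' + h)) (x N' + (- x N' + h))"
          unfolding g_def by (simp add: add.assoc[symmetric])
        also have "\<dots> = d (x n) (x N')" by (rule right_invariant)
        finally have "d (x n + g) h < s/2"
          using N1[of n N'] that(1) by (simp add: N'_def)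
        then show ?thesis
          using triangle[of h "x n + g" a] that(2) by (simp add: commute)
      qed
      have "dist a b < inverse (real (Suc k))" if "d h a < s" "d h b < s" for a b
      proof -
        have "dist a b < inverse (2 * real (Suc k)) + inverse (2 * real (Suc k))"
          using s(2)[OF that(1)] s(2)[OF that(2)] dist_triangle3[of a b h] by linarith
        then show ?thesis by (simp add: field_simps)
      qed
      then have "g \<in> D k"
        unfolding D_def using close s(1)
        by (intro CollectI exI[of _ "s/2"]) (auto intro!: exI[of _ N'])
      moreover have "d g0 g = d (x N' + g0) (x N' + (- x N' + (x N + g0)))"
        unfolding g_def h_def by (simp only: left_invariant)
      then have "d g0 g < \<delta>"
        using N[of N' N] by (simp add: add.assoc[symmetric] N'_def)
      ultimately show ?thesis using \<delta>(2) by blast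
    qed
    then show "closure (D k) = UNIV"
      unfolding closure_iff_nhds_not_empty set_eq_iff by blast
  qed
  have "closure (\<Inter>(range D)) = (UNIV :: 'a set)"
    using Met_TC.metric_Baire_category[of "range D"] D by (force simp: complete_UNIV)
  then have "\<Inter>(range D) \<noteq> {}" by force
  then obtain g where g: "g \<in> D k" for k
    by blast
  have "Cauchy (\<lambda>n. x n + g)"
    unfolding Cauchy_def
  proof (intro allI impI)
    fix e :: real assume "e > 0"
    then obtain k where k: "inverse (real (Suc k)) < e"
      using reals_Archimedean by blast
    obtain r N where rN: "r > 0" "\<And>n m a b. n \<ge> N \<Longrightarrow> m \<ge> N \<Longrightarrow>
        d (x n + g) a < r \<Longrightarrow> d (x m + g) b < r \<Longrightarrow> dist a b < inverse (real (Suc k))"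
      using g[of k] unfolding D_def by blast
    have "dist (x m + g) (x n + g) < e" if "m \<ge> N" "n \<ge> N" for m n
      using rN(2)[of m n "x m + g" "x n + g"] rN(1) that k by simp
    then show "\<exists>M. \<forall>m\<ge>M. \<forall>n\<ge>M. dist (x m + g) (x n + g) < e" by blast
  qed
  then obtain y where "(\<lambda>n. x n + g) \<longlonglongrightarrow> y"
    using Cauchy_convergent convergent_def by blast
  then have "(\<lambda>n. (x n + g) + - g) \<longlonglongrightarrow> y + - g"
    by (intro tendsto_add tendsto_const)
  then have "x \<longlonglongrightarrow> y + - g" by (simp add: add.assoc)
  then show "\<exists>l. limitin mtopology x l sequentially" by auto
qed

text \<open>
  The points caught at all times from \<open>m\<close> on form a totally bounded set, because for each
  \<open>n \<ge> m\<close> they are covered by finitely many balls of radius at most \<open>1 / Suc n\<close>.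
\<close>
lemma sharp_measure_zero_imp_sigma_compact:
  assumes "sharp_measure_zero d X"
  obtains K :: "nat \<Rightarrow> 'a set"
    where "\<And>n. compact (K n)" "incseq K" "X \<subseteq> (\<Union>n. K n)"
proof -
  have "\<forall>j. 0 < inverse (real (Suc j))" by simp
  then obtain E :: "nat \<Rightarrow> 'a set" and g where E: "\<And>j. finite (E j)"
    and g: "\<And>x. x \<in> X \<Longrightarrow>
        \<forall>\<^sub>F n in sequentially. \<exists>j\<in>{n..<g n}. \<exists>u\<in>E j. d x u < inverse (real (Suc j))"
    using assms[unfolded sharp_measure_zero_def, rule_format, of "\<lambda>j. inverse (real (Suc j))"]
    by auto
  define T where "T m = {x. \<forall>n\<ge>m. \<exists>j\<in>{n..<g n}. \<exists>u\<in>E j. d x u < inverse (real (Suc j))}" for m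
  have T: "mtotally_bounded (T m)" for m
    unfolding mtotally_bounded_def
  proof (intro allI impI)
    fix e :: real assume e: "e > 0"
    obtain k where k: "inverse (real (Suc k)) < e/2"
      using reals_Archimedean e by (metis half_gt_zero)
    define n where "n = max m k"
    define P where "P = {u \<in> \<Union>j\<in>{n..<g n}. E j. \<exists>x\<in>T m. d x u < e/2}"
    obtain c where c: "\<And>u. u \<in> P \<Longrightarrow> c u \<in> T m \<and> d (c u) u < e/2"
    proof
      fix u assume "u \<in> P"
      then show "(SOME x. x \<in> T m \<and> d x u < e/2) \<in> T m \<and> d (SOME x. x \<in> T m \<and> d x u < e/2) u < e/2"
        unfolding P_def by (intro someI_ex[of "\<lambda>x. x \<in> T m \<and> d x u < e/2"]) blast
    qed
    show "\<exists>N. finite N \<and> N \<subseteq> T m \<and> T m \<subseteq> (\<Union>x\<in>N. mball x e)"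
    proof (intro exI conjI subsetI)
      show "finite (c ` P)" unfolding P_def using E by auto
      show "x \<in> T m" if "x \<in> c ` P" for x using that c by auto
      fix x assume x: "x \<in> T m"
      then obtain j u where j: "j \<in> {n..<g n}" "u \<in> E j" "d x u < inverse (real (Suc j))"
        unfolding T_def n_def by (auto dest!: spec[of _ "max m k"])
      have "inverse (real (Suc j)) \<le> inverse (real (Suc k))"
        using j(1) by (simp add: n_def)
      then have xu: "d x u < e/2" using j(3) k by linarith
      then have u: "u \<in> P" unfolding P_def using j x by blast
      have "d (c u) x < e"
        using triangle[of "c u" u x] c[OF u] xu by (simp add: commute)
      then show "x \<in> (\<Union>x\<in>c ` P. mball x e)" using u by auto
    qed
  qed
  show thesis
  proof
    have "compactin mtopology (mtopology closure_of T n)" for n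
      using mtotally_bounded_eq_compact_closure_of[OF invariant_metric_complete] T by blast
    then show "compact (closure (T n))" for n by simp
    show "incseq (\<lambda>n. closure (T n))"
      by (intro monoI closure_mono) (auto simp: T_def)
    show "X \<subseteq> (\<Union>n. closure (T n))"
    proof
      fix x assume "x \<in> X"
      then obtain m where "x \<in> T m"
        using g unfolding eventually_sequentially T_def by blast
      then show "x \<in> (\<Union>n. closure (T n))" using closure_subset by blast
    qed
  qed
qed

section \<open>Meager-additive sets have sharp measure zero\<close>

text \<open>
  The construction with walks requires arbitrarily short nonzero steps.  Without them the
  group is discrete, hence countable.
\<close>
lemma meager_additive_imp_sharp_measure_zero:
  assumes "meager_additive X"
  shows "sharp_measure_zero d X"
proof (cases "\<exists>\<eta>>0. \<forall>v. d 0 v < \<eta> \<longrightarrow> v = 0")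
  case True
  then obtain \<eta> where \<eta>: "\<eta> > 0" "\<And>v. d 0 v < \<eta> \<Longrightarrow> v = 0" by blast
  obtain D :: "'a set" where D: "countable D" "\<And>U. open U \<Longrightarrow> U \<noteq> {} \<Longrightarrow> \<exists>y\<in>D. y \<in> U"
    using countable_dense_setE by blast
  have "x \<in> D" for x
  proof -
    have "x = y" if "d x y < \<eta>" for y
      using \<eta>(2)[of "- x + y"] left_invariant[of "- x" x y] that
      by (metis left_minus add.left_cancel)
    moreover have "x \<in> {y. d x y < \<eta>}" using \<eta>(1) by simp
    ultimately show ?thesis using D(2)[OF open_metric_ball[of x \<eta>]] by blast
  qed
  then have "countable X" using D(1) by (metis countable_subset subsetI)
  then show ?thesis by (rule sharp_measure_zero_countable) simp
next
  case False
  then have small: "\<exists>v. v \<noteq> 0 \<and> d 0 v < \<eta>" if "\<eta> > 0" for \<eta>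
    using that by blast
  show ?thesis
    unfolding sharp_measure_zero_def
  proof (intro allI impI)
    fix \<epsilon> :: "nat \<Rightarrow> real" assume \<epsilon>: "\<forall>j. 0 < \<epsilon> j"
    have "\<exists>v. \<forall>n. (v n \<noteq> 0 \<and> d 0 (v n) \<le> \<epsilon> n) \<and> d 0 (v (Suc n)) \<le> d 0 (v n) / 16"
    proof (rule dependent_nat_choice)
      show "\<exists>v. v \<noteq> 0 \<and> d 0 v \<le> \<epsilon> 0"
        using small \<epsilon> less_imp_le by metis
      fix v n assume "v \<noteq> 0 \<and> d 0 v \<le> \<epsilon> n"
      then have "0 < min (\<epsilon> (Suc n)) (d 0 v / 16)" using \<epsilon> by auto
      then show "\<exists>v'. (v' \<noteq> 0 \<and> d 0 v' \<le> \<epsilon> (Suc n)) \<and> d 0 v' \<le> d 0 v / 16"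
        using small by (metis less_imp_le min_less_iff_conj)
    qed
    then obtain v where v: "\<And>n. v n \<noteq> 0" "\<And>n. d 0 (v n) \<le> \<epsilon> n"
        "\<And>n. d 0 (v (Suc n)) \<le> d 0 (v n) / 16" by blast
    define w where "w n = d 0 (v n)" for n
    have w_pos: "0 < w n" for n using v(1) by (simp add: w_def)
    have w_Suc: "w (Suc n) \<le> w n / 16" for n using v(3) by (simp add: w_def)
    have w_mono: "w k \<le> w n" if "n \<le> k" for n k
      using that
    proof (induction rule: dec_induct)
      case (step k) then show ?case using w_Suc[of k] w_pos[of k] by linarith
    qed simp
    have w_less: "w k \<le> w n / 16" if "n < k" for n k
      using w_mono[of "Suc n" k] w_Suc[of n] that by linarith
    have w_small: "\<exists>n. w n < \<eta>" if "\<eta> > 0" for \<eta>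
    proof -
      have *: "w n \<le> w 0 * (1/2)^n" for n
      proof (induction n)
        case (Suc n) then show ?case using w_Suc[of n] w_pos[of n] by simp
      qed simp
      obtain n where "(1/2)^n < \<eta> / w 0"
        using real_arch_pow_inv[of "\<eta> / w 0" "1/2"] divide_pos_pos[OF \<open>\<eta> > 0\<close> w_pos[of 0]] by auto
      then have "w 0 * (1/2)^n < \<eta>" using w_pos[of 0] by (simp add: field_simps)
      then show ?thesis using *[of n] by (intro exI[of _ n]) linarith
    qed

    obtain D :: "'a set" where D: "countable D" "\<And>U. open U \<Longrightarrow> U \<noteq> {} \<Longrightarrow> \<exists>y\<in>D. y \<in> U"
      using countable_dense_setE by blast
    have "D \<noteq> {}" using D(2)[of UNIV] by auto
    define p where "p = from_nat_into D"
    have p: "\<exists>j. p j \<in> U" if "open U" "U \<noteq> {}" for U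
      using D(2)[OF that] from_nat_into_surj[OF D(1)] unfolding p_def by metis
    \<comment> \<open>The divisor 4 leaves slack: a walk has distance at least \<open>w j / 2\<close> from \<open>p j + x\<close> just
      after time \<open>j\<close>, and its limit is at most \<open>w j / 8\<close> away from there.\<close>
    define M where "M = {z. \<forall>j. w j / 4 \<le> d (p j) z}"
    have "M = (\<Inter>j. - {z. d (p j) z < w j / 4})"
      unfolding M_def by (simp add: set_eq_iff not_less)
    then have "closed M" by (simp only:) (intro closed_INT ballI closed_Compl open_metric_ball)
    moreover have "interior M = {}"
    proof (rule ccontr)
      assume "interior M \<noteq> {}"
      then obtain j where "p j \<in> M" using p[of "interior M"] interior_subset by blast
      then have "w j / 4 \<le> d (p j) (p j)" unfolding M_def by blast
      then show False using w_pos[of j] by simp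
    qed
    ultimately have "nowhere_dense M" by (simp add: nowhere_dense_def)
    then have "meager M"
      unfolding meager_def by (intro exI[of _ "{M}"]) auto
    then have "meager {m + x |m x. m \<in> M \<and> x \<in> X}"
      using assms unfolding meager_additive_def by blast
    then obtain H :: "nat \<Rightarrow> 'a set" where H: "\<And>n. closed (H n)" "\<And>n. interior (H n) = {}" "incseq H"
        and MX: "{m + x |m x. m \<in> M \<and> x \<in> X} \<subseteq> (\<Union>n. H n)"
      by (rule meager_increasing_closed_cover) blast

    have "\<exists>a' \<delta>. d a a' \<le> w n \<and> \<delta> > 0 \<and> (\<forall>y. d a' y < \<delta> \<longrightarrow> y \<notin> H n)" for n a
    proof -
      have "a \<in> {y. d a y < w n}" using w_pos[of n] by simp
      then have "\<not> {y. d a y < w n} \<subseteq> H n"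
        using interior_maximal[OF _ open_metric_ball[of a "w n"], of "H n"] H(2)[of n] by blast
      then obtain a' where a': "d a a' < w n" "a' \<in> - H n" by auto
      moreover obtain \<delta> where "\<delta> > 0" "\<And>y. d a' y < \<delta> \<Longrightarrow> y \<in> - H n"
        using H(1)[of n] a'(2) open_iff[of "- H n"] by (meson open_Compl)
      ultimately show ?thesis by (meson ComplD less_imp_le)
    qed
    then have "\<forall>n a. \<exists>a' \<delta>. d a a' \<le> w n \<and> \<delta> > 0 \<and> (\<forall>y. d a' y < \<delta> \<longrightarrow> y \<notin> H n)"
      by blast
    then obtain J \<Delta> where "\<forall>n a. d a (J n a) \<le> w n \<and> \<Delta> n a > (0::real) \<and>
        (\<forall>y. d (J n a) y < \<Delta> n a \<longrightarrow> y \<notin> H n)"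
      unfolding choice_iff by blast
    then have J: "\<And>n a. d a (J n a) \<le> w n" and \<Delta>: "\<And>n a. \<Delta> n a > 0"
      and JH: "\<And>n a y. d (J n a) y < \<Delta> n a \<Longrightarrow> y \<notin> H n"
      by blast+
    \<comment> \<open>\<open>A n\<close> collects all points that a walk can occupy at time \<open>n\<close>: it rests, steps by
      \<open>v n\<close>, or jumps by \<open>J n\<close>.\<close>
    define A where "A = rec_nat {0} (\<lambda>n S. S \<union> (\<lambda>a. a + v n) ` S \<union> J n ` S)"
    have A0: "A 0 = {0}" and A_Suc: "A (Suc n) = A n \<union> (\<lambda>a. a + v n) ` A n \<union> J n ` A n" for n
      by (simp_all add: A_def)
    have A_fin: "finite (A n) \<and> card (A n) \<le> 3 ^ n" for n
    proof (induction n)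
      case (Suc n)
      have "card (A (Suc n)) \<le> card (A n) + card ((\<lambda>a. a + v n) ` A n) + card (J n ` A n)"
        unfolding A_Suc by (meson add_mono card_Un_le le_refl order_trans)
      also have "\<dots> \<le> card (A n) + card (A n) + card (A n)"
        using Suc by (intro add_mono card_image_le) auto
      finally show ?case using Suc by (simp add: A_Suc)
    qed (simp add: A0)
    have A_mono: "A n \<subseteq> A k" if "n \<le> k" for n k
      using lift_Suc_mono_le[of A n k] A_Suc that by blast
    \<comment> \<open>From time \<open>k\<close> on, a walk moves by at most \<open>2 * w k\<close> in total.\<close>
    have "\<exists>k>n. \<forall>a\<in>A n. 2 * w k < \<Delta> n a" for n
    proof -
      define \<eta> where "\<eta> = Min (insert 1 (\<Delta> n ` A n))"
      have \<eta>: "\<eta> > 0" "\<And>a. a \<in> A n \<Longrightarrow> \<eta> \<le> \<Delta> n a"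
        using A_fin[of n] \<Delta> by (auto simp: \<eta>_def)
      obtain k where k: "w k < \<eta>/2" using w_small \<eta>(1) by (meson half_gt_zero)
      have "w (max k (Suc n)) < \<eta>/2" using w_mono[of k "max k (Suc n)"] k by linarith
      then show ?thesis using \<eta>(2) by (intro exI[of _ "max k (Suc n)"]) force
    qed
    then obtain g where g: "\<And>n. g n > n" "\<And>n a. a \<in> A n \<Longrightarrow> 2 * w (g n) < \<Delta> n a"
      by metis
    \<comment> \<open>All jump targets \<open>J n a\<close> with \<open>a \<in> A n\<close> and \<open>n \<le> j\<close> lie in \<open>A (Suc j)\<close>.\<close>
    define E where "E j = (\<lambda>a. - p j + a) ` A (Suc j)" for j
    have E_fin: "finite (E j) \<and> card (E j) \<le> 3 ^ Suc j" for j
      unfolding E_def using A_fin[of "Suc j"] card_image_le[of "A (Suc j)" "\<lambda>a. - p j + a"]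
      by (meson finite_imageI order_trans)

    have good: "\<forall>\<^sub>F n in sequentially. \<exists>j\<in>{n..<g n}. \<exists>u\<in>E j. d x u < \<epsilon> j" if x: "x \<in> X" for x
    proof (rule ccontr)
      assume not_good: "\<not> ?thesis"
      define bad where "bad n \<longleftrightarrow> (\<forall>j\<in>{n..<g n}. \<forall>u\<in>E j. \<epsilon> j \<le> d x u)" for n
      have inf_bad: "\<exists>n\<ge>N. bad n" for N
        using not_good unfolding eventually_sequentially bad_def by (meson not_less)
      \<comment> \<open>A state of the walk is a time together with a position; time advances by 1 in an
        ordinary step, and from \<open>n\<close> to \<open>g n\<close> in a jump, which is made whenever \<open>n\<close> is bad.\<close>
      define P where "P i s \<longleftrightarrow> snd s \<in> A (fst s) \<and> (i = 0 \<longrightarrow> fst s = 0)" for i :: nat and s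
      define Q where "Q s s' \<longleftrightarrow> fst s < fst s' \<and> d (snd s) (snd s') \<le> w (fst s) \<and>
          (\<forall>j\<in>{fst s..<fst s'}. w j / 2 \<le> d (p j + x) (snd s')) \<and>
          (bad (fst s) \<longrightarrow> (\<forall>y. d (snd s') y \<le> 2 * w (fst s') \<longrightarrow> y \<notin> H (fst s))) \<and>
          (\<not> bad (fst s) \<longrightarrow> fst s' = Suc (fst s))" for s s'
      have "\<exists>s. \<forall>i. P i (s i) \<and> Q (s i) (s (Suc i))"
      proof (rule dependent_nat_choice)
        show "\<exists>s. P 0 s" by (intro exI[of _ "(0,0)"]) (simp add: P_def A0)
        fix s i assume "P i s"
        obtain n z where s: "s = (n, z)" by (cases s)
        have z: "z \<in> A n" using \<open>P i s\<close> by (simp add: P_def s)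
        show "\<exists>s'. P (Suc i) s' \<and> Q s s'"
        proof (cases "bad n")
          case True
          have "w j / 2 \<le> d (p j + x) (J n z)" if j: "j \<in> {n..<g n}" for j
          proof -
            have "J n z \<in> A (Suc j)" using A_mono[of "Suc n" "Suc j"] A_Suc[of n] z j by auto
            then have "\<epsilon> j \<le> d x (- p j + J n z)" using True j unfolding bad_def E_def by blast
            also have "\<dots> = d (p j + x) (p j + (- p j + J n z))" by (simp only: left_invariant)
            finally have "\<epsilon> j \<le> d (p j + x) (J n z)" by simp
            moreover have "w j \<le> \<epsilon> j" using v(2) by (simp add: w_def)
            ultimately show ?thesis using w_pos[of j] by linarith
          qed
          moreover have "J n z \<in> A (g n)"
            using A_mono[of "Suc n" "g n"] A_Suc[of n] z g(1)[of n] by auto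
          moreover have "y \<notin> H n" if "d (J n z) y \<le> 2 * w (g n)" for y
            using JH[of n z y] g(2)[OF z] that by linarith
          ultimately show ?thesis
            using True g(1)[of n] J[of z n] unfolding P_def Q_def s
            by (intro exI[of _ "(g n, J n z)"]) auto
        next
          case False
          \<comment> \<open>The points \<open>z\<close> and \<open>z + v n\<close> have distance \<open>w n\<close>, so one of them is far from \<open>p n + x\<close>.\<close>
          have wn: "w n = d z (z + v n)" using left_invariant[of z 0 "v n"] by (simp add: w_def)
          then have "w n \<le> d (p n + x) z + d (p n + x) (z + v n)"
            using triangle[of z "p n + x" "z + v n"] by (simp add: commute)
          then have "\<exists>z'\<in>{z, z + v n}. w n / 2 \<le> d (p n + x) z'" by force
          then obtain z' where z': "z' \<in> {z, z + v n}" "w n / 2 \<le> d (p n + x) z'" by blast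
          have "d z z' \<le> w n" using z'(1) wn w_pos[of n] by auto
          moreover have "z' \<in> A (Suc n)" using z'(1) z A_Suc[of n] by auto
          ultimately show ?thesis
            using False z'(2) unfolding P_def Q_def s
            by (intro exI[of _ "(Suc n, z')"]) (auto simp: less_Suc_eq)
        qed
      qed
      then obtain s where s: "\<And>i. P i (s i)" "\<And>i. Q (s i) (s (Suc i))" by blast
      define n where "n i = fst (s i)" for i
      define z where "z i = snd (s i)" for i
      have n0: "n 0 = 0" and n_less: "n i < n (Suc i)" and z_dist: "d (z i) (z (Suc i)) \<le> w (n i)"
        and z_far: "\<And>j. n i \<le> j \<Longrightarrow> j < n (Suc i) \<Longrightarrow> w j / 2 \<le> d (p j + x) (z (Suc i))"
        and z_H: "\<And>y. bad (n i) \<Longrightarrow> d (z (Suc i)) y \<le> 2 * w (n (Suc i)) \<Longrightarrow> y \<notin> H (n i)"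
        and n_Suc: "\<not> bad (n i) \<Longrightarrow> n (Suc i) = Suc (n i)" for i
        using s(1)[of 0] s(2)[of i] unfolding P_def Q_def n_def z_def by auto
      have n_strict: "strict_mono n" using n_less by (simp add: strict_mono_Suc_iff)
      have tail: "d (z i) (z k) \<le> 2 * w (n i) - 2 * w (n k)" if "i \<le> k" for i k
        using that
      proof (induction rule: dec_induct)
        case (step k)
        have "w (n (Suc k)) \<le> w (n k) / 16" using w_less n_less by blast
        then show ?case
          using step.IH triangle[of "z i" "z k" "z (Suc k)"] z_dist[of k] w_pos[of "n k"] by simp
      qed simp
      have "MCauchy z"
        unfolding MCauchy_def
      proof (intro conjI allI impI)
        fix e :: real assume "e > 0"
        then obtain N where N: "w N < e/4" using w_small[of "e/4"] by auto
        have "d (z i) (z k) < e" if "N \<le> i" "N \<le> k" for i k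
        proof -
          have "w (n N) \<le> w N" using w_mono strict_mono_imp_increasing[OF n_strict] by blast
          then show ?thesis
            using tail[OF that(1)] tail[OF that(2)] triangle[of "z i" "z N" "z k"] N
              w_pos[of "n i"] w_pos[of "n k"] by (simp add: commute)
        qed
        then show "\<exists>N. \<forall>i k. N \<le> i \<longrightarrow> N \<le> k \<longrightarrow> d (z i) (z k) < e" by blast
      qed simp
      then obtain l where l: "limitin mtopology z l sequentially"
        using invariant_metric_complete unfolding mcomplete_def by blast
      have zl: "d (z i) l \<le> 2 * w (n i)" for i
      proof (rule field_le_epsilon)
        fix e :: real assume "e > 0"
        then obtain N where N: "\<And>k. k \<ge> N \<Longrightarrow> d (z k) l < e"
          using l unfolding limit_metric_sequentially by blast
        show "d (z i) l \<le> 2 * w (n i) + e"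
          using N[of "max i N"] tail[of i "max i N"] w_pos[of "n (max i N)"]
            triangle[of "z i" "z (max i N)" l] by simp
      qed
      have "w j / 4 \<le> d (p j) (l - x)" for j
      proof -
        have "\<exists>i. n i \<le> j \<and> j < n (Suc i)"
        proof -
          have "\<exists>i. j < n i" using strict_mono_imp_increasing[OF n_strict, of "Suc j"] by (intro exI[of _ "Suc j"]) simp
          then obtain i where "j < n i" "\<And>k. k < i \<Longrightarrow> \<not> j < n k"
            using exists_least_iff[of "\<lambda>i. j < n i"] by blast
          then show ?thesis using n0 by (cases i) (auto simp: not_less)
        qed
        then obtain i where i: "n i \<le> j" "j < n (Suc i)" by blast
        have "w j / 2 \<le> d (p j + x) (z (Suc i))" using z_far i by blast
        moreover have "d (z (Suc i)) l \<le> w j / 8"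
          using zl[of "Suc i"] w_less[OF i(2)] by linarith
        ultimately have "w j / 4 \<le> d (p j + x) l"
          using triangle[of "p j + x" l "z (Suc i)"] w_pos[of j] by (simp add: commute)
        also have "\<dots> = d (p j + x) (l - x + x)" by simp
        also have "\<dots> = d (p j) (l - x)" by (rule right_invariant)
        finally show ?thesis .
      qed
      then have "l - x \<in> M" unfolding M_def by blast
      then have "l - x + x \<in> (\<Union>n. H n)" using MX x by blast
      then obtain k where k: "l \<in> H k" by auto
      \<comment> \<open>Jumps may skip bad times, but without further jumps the walk visits every later time.\<close>
      have "\<exists>i\<ge>k. bad (n i)"
      proof (rule ccontr)
        assume none: "\<not> ?thesis"
        then have step: "n (Suc i) = Suc (n i)" if "i \<ge> k" for i using n_Suc that by blast
        have shift: "n (k + i) = n k + i" for i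
          by (induction i) (use step in auto)
        obtain m where m: "m \<ge> n k" "bad m" using inf_bad by blast
        then have "m = n (k + (m - n k))" by (metis shift le_add_diff_inverse)
        then show False using none m(2) by (metis le_add1)
      qed
      then obtain i where i: "i \<ge> k" "bad (n i)" by blast
      have "l \<notin> H (n i)" using z_H[OF i(2)] zl by blast
      moreover have "k \<le> n i" using i(1) strict_mono_imp_increasing[OF n_strict, of i] by linarith
      ultimately show False using k H(3) unfolding incseq_def by blast
    qed
    show "\<exists>E g. (\<forall>j. finite (E j) \<and> card (E j) \<le> 3 ^ Suc j) \<and>
        (\<forall>x\<in>X. \<forall>\<^sub>F n in sequentially. \<exists>j\<in>{n..<g n}. \<exists>u\<in>E j. d x u < \<epsilon> j)"
      using E_fin good by blast
  qed
qed

end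

section \<open>Images of sets of sharp measure zero\<close>

text \<open>
  An open set disjoint from the shadow avoids \<open>F + f y\<close> for all points \<open>y\<close> of \<open>K\<close> that are
  caught by the balls of radius \<open>e\<close> around \<open>E\<close>.
\<close>
definition shadow :: "('a \<Rightarrow> 'b) \<Rightarrow> ('a \<Rightarrow> 'a \<Rightarrow> real) \<Rightarrow> 'b::plus set \<Rightarrow> 'a set \<Rightarrow> real \<Rightarrow> 'a set \<Rightarrow> 'b set" where
  "shadow f d F K e E = {a + f y |a y. a \<in> F \<and> y \<in> K \<and> (\<exists>u\<in>E. d y u < e)}"

lemma shadow_mono:
  "e \<le> e' \<Longrightarrow> E \<subseteq> E' \<Longrightarrow> shadow f d F K e E \<subseteq> shadow f d F K e' E'"
  unfolding shadow_def by (blast intro: less_le_trans)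

lemma shadow_Un: "shadow f d F K e (E \<union> E') = shadow f d F K e E \<union> shadow f d F K e E'"
  unfolding shadow_def by blast

text \<open>
  As \<open>F + f x\<close> has empty interior, some \<open>w \<in> W\<close> satisfies \<open>w - f x \<notin> F\<close>.  This condition
  on \<open>(w, x)\<close> is open.
\<close>
lemma avoid_translates_near_point:
  fixes f :: "'a::topological_space \<Rightarrow> 'b::topological_group_add"
  assumes "continuous_on UNIV f" "closed F" "interior F = {}" "open W" "W \<noteq> {}"
  obtains V U where "open V" "V \<noteq> {}" "V \<subseteq> W" "open U" "x \<in> U"
    "\<And>w y a. w \<in> V \<Longrightarrow> y \<in> U \<Longrightarrow> a \<in> F \<Longrightarrow> w \<noteq> a + f y"
proof -
  have "open ((\<lambda>z. z + f x) -` W)"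
    using assms(4) by (intro open_vimage continuous_intros)
  moreover have "(\<lambda>z. z + f x) -` W \<noteq> {}"
    using assms(5) by (metis diff_add_cancel ex_in_conv vimageI)
  ultimately have "\<not> (\<lambda>z. z + f x) -` W \<subseteq> F"
    using assms(3) interior_maximal[of "(\<lambda>z. z + f x) -` W" F] by auto
  then obtain z where z: "z + f x \<in> W" "z \<notin> F" by auto
  define S where "S = {q. fst q - f (snd q) \<in> - F \<and> fst q \<in> W}"
  have "S = (\<lambda>q. fst q - f (snd q)) -` (- F) \<inter> fst -` W" by (auto simp: S_def)
  moreover have "continuous_on UNIV (\<lambda>q::'b \<times> 'a. f (snd q))"
    by (rule continuous_on_compose2[OF assms(1)]) (auto intro: continuous_intros)
  ultimately have "open S"
    using assms(2,4) by (auto intro!: open_Int open_vimage continuous_intros)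
  moreover have "(z + f x, x) \<in> S" using z by (simp add: S_def)
  ultimately obtain V U where VU: "open V" "open U" "(z + f x, x) \<in> V \<times> U" "V \<times> U \<subseteq> S"
    by (rule open_prod_elim)
  show thesis
  proof
    show "V \<noteq> {}" "x \<in> U" using VU(3) by auto
    show "V \<subseteq> W" using VU(3,4) by (auto simp: S_def)
    fix w y a assume "w \<in> V" "y \<in> U" "a \<in> F"
    moreover have "(w, y) \<in> S" using VU(4) calculation by blast
    ultimately show "w \<noteq> a + f y" by (auto simp: S_def)
  qed (use VU in auto)
qed

text \<open>
  Finitely many of the neighbourhoods \<open>U\<close> of the preceding lemma cover \<open>K\<close>.  Twice
  the radius \<open>e\<close> is a Lebesgue number of this cover, so a ball of radius \<open>e\<close> meets \<open>K\<close>
  inside a single \<open>U\<close>.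
\<close>
lemma avoid_translates_near_compact:
  fixes f :: "'a::topological_space \<Rightarrow> 'b::topological_group_add"
  assumes "Metric_space UNIV d" "Metric_space.mtopology UNIV d = euclidean"
    and "continuous_on UNIV f" "closed F" "interior F = {}" "compact K" "open W" "W \<noteq> {}"
  shows "\<exists>e>0. \<exists>\<V>. finite \<V> \<and> (\<forall>V\<in>\<V>. open V \<and> V \<noteq> {}) \<and>
    (\<forall>u. \<exists>V\<in>\<V>. V \<subseteq> W \<and> V \<inter> shadow f d F K e {u} = {})"
proof -
  interpret Metric_space UNIV d by fact
  have "\<exists>V U. open V \<and> V \<noteq> {} \<and> V \<subseteq> W \<and> open U \<and> x \<in> U \<and>
      (\<forall>w\<in>V. \<forall>y\<in>U. \<forall>a\<in>F. w \<noteq> a + f y)" for x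
    by (rule avoid_translates_near_point[OF assms(3-5,7,8), of x]) blast
  then obtain V U where V: "\<And>x. open (V x)" "\<And>x. V x \<noteq> {}" "\<And>x. V x \<subseteq> W"
    and U: "\<And>x. open (U x)" "\<And>x. x \<in> U x"
    and VU: "\<And>x w y a. w \<in> V x \<Longrightarrow> y \<in> U x \<Longrightarrow> a \<in> F \<Longrightarrow> w \<noteq> a + f y"
    by metis
  obtain I where I: "finite I" "K \<subseteq> (\<Union>x\<in>I. U x)"
    by (rule compactE_image[OF assms(6), of UNIV U]) (use U in blast)+
  have "\<exists>e>0. \<forall>y\<in>K. \<exists>U'\<in>U ` I. mball y e \<subseteq> U'"
    by (rule lebesgue_number) (use assms(2,6) U(1) I(2) in auto)
  then obtain e where e: "e > 0" "\<And>y. y \<in> K \<Longrightarrow> \<exists>x\<in>I. mball y e \<subseteq> U x"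
    by auto
  have "\<exists>V'\<in>insert W (V ` I). V' \<subseteq> W \<and> V' \<inter> shadow f d F K (e/2) {u} = {}" for u
  proof (cases "\<exists>y\<in>K. d y u < e/2")
    case True
    then obtain y where y: "y \<in> K" "d y u < e/2" by blast
    then obtain x where x: "x \<in> I" "mball y e \<subseteq> U x" using e(2) by blast
    have in_U: "y' \<in> U x" if "d y' u < e/2" for y'
    proof -
      have "d y y' < e" using triangle[of y u y'] y(2) that by (simp add: commute)
      then show ?thesis using x(2) by auto
    qed
    have "w \<notin> shadow f d F K (e/2) {u}" if "w \<in> V x" for w
      using VU[OF that] in_U unfolding shadow_def by blast
    then have "V x \<inter> shadow f d F K (e/2) {u} = {}" by blast
    then show ?thesis using V(3) x(1) by (intro bexI[of _ "V x"] conjI) simp_all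
  next
    case False
    then show ?thesis unfolding shadow_def by auto
  qed
  then show ?thesis
    using e(1) I(1) V assms(7,8)
    by (intro exI[of _ "e/2"] conjI exI[of _ "insert W (V ` I)"]) auto
qed

text \<open>
  The balls are avoided one after the other: each of the finitely many sets that avoid
  \<open>N\<close> balls is shrunk further to avoid one more.  The number \<open>N\<close> has to be fixed before the
  radius.
\<close>
lemma avoid_translates_uniformly:
  fixes f :: "'a::topological_space \<Rightarrow> 'b::topological_group_add"
  assumes "Metric_space UNIV d" "Metric_space.mtopology UNIV d = euclidean"
    and "continuous_on UNIV f" "closed F" "interior F = {}" "compact K"
    and "finite \<W>" "\<forall>W\<in>\<W>. open W \<and> W \<noteq> {}"
  shows "\<exists>e>0. \<exists>\<V>. finite \<V> \<and> (\<forall>V\<in>\<V>. open V \<and> V \<noteq> {}) \<and>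
    (\<forall>W\<in>\<W>. \<forall>E. finite E \<and> card E \<le> N \<longrightarrow> (\<exists>V\<in>\<V>. V \<subseteq> W \<and> V \<inter> shadow f d F K e E = {}))"
proof (induction N)
  case 0
  show ?case using assms(7,8)
    by (intro exI[of _ 1] conjI exI[of _ \<W>]) (auto simp: shadow_def)
next
  case (Suc N)
  obtain e1 \<V>1 where e1: "e1 > 0" and \<V>1: "finite \<V>1" "\<forall>V\<in>\<V>1. open V \<and> V \<noteq> {}"
    and step1: "\<forall>W\<in>\<W>. \<forall>E. finite E \<and> card E \<le> N \<longrightarrow>
        (\<exists>V\<in>\<V>1. V \<subseteq> W \<and> V \<inter> shadow f d F K e1 E = {})"
    using Suc.IH by - (elim exE conjE, rule that)
  have "\<forall>W\<in>\<V>1. \<exists>e>0. \<exists>\<V>. finite \<V> \<and> (\<forall>V\<in>\<V>. open V \<and> V \<noteq> {}) \<and>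
      (\<forall>u. \<exists>V\<in>\<V>. V \<subseteq> W \<and> V \<inter> shadow f d F K e {u} = {})"
    using \<V>1(2) by (intro ballI avoid_translates_near_compact[OF assms(1-6)]) simp_all
  then obtain e2 \<V>2 where e2: "\<And>W. W \<in> \<V>1 \<Longrightarrow> e2 W > 0"
    and \<V>2: "\<And>W. W \<in> \<V>1 \<Longrightarrow> finite (\<V>2 W)" "\<And>W V. W \<in> \<V>1 \<Longrightarrow> V \<in> \<V>2 W \<Longrightarrow> open V \<and> V \<noteq> {}"
    and step2: "\<And>W u. W \<in> \<V>1 \<Longrightarrow> \<exists>V\<in>\<V>2 W. V \<subseteq> W \<and> V \<inter> shadow f d F K (e2 W) {u} = {}"
    by metis
  define e where "e = Min (insert e1 (e2 ` \<V>1))"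
  have e: "e > 0" "e \<le> e1" "\<And>W. W \<in> \<V>1 \<Longrightarrow> e \<le> e2 W"
    using \<V>1(1) e1 e2 by (auto simp: e_def)
  have "\<exists>V\<in>\<Union>(\<V>2 ` \<V>1). V \<subseteq> W \<and> V \<inter> shadow f d F K e E = {}"
    if W: "W \<in> \<W>" and E: "finite E" "card E \<le> Suc N" for W E
  proof -
    obtain u where u: "card (E - {u}) \<le> N"
    proof (cases "E = {}")
      case False
      then obtain u where "u \<in> E" by blast
      then show thesis using E that[of u] by simp
    qed (use that in auto)
    obtain V1 where V1: "V1 \<in> \<V>1" "V1 \<subseteq> W" "V1 \<inter> shadow f d F K e1 (E - {u}) = {}"
      using step1 W u E(1) by (metis finite_Diff)
    obtain V2 where V2: "V2 \<in> \<V>2 V1" "V2 \<subseteq> V1" "V2 \<inter> shadow f d F K (e2 V1) {u} = {}"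
      using step2[OF V1(1)] by blast
    have "shadow f d F K e E \<subseteq> shadow f d F K e ((E - {u}) \<union> {u})"
      by (rule shadow_mono) auto
    also have "\<dots> \<subseteq> shadow f d F K e1 (E - {u}) \<union> shadow f d F K (e2 V1) {u}"
      unfolding shadow_Un using e(2) e(3)[OF V1(1)] by (intro Un_mono shadow_mono) auto
    finally have sub: "shadow f d F K e E \<subseteq> \<dots>" .
    have "V2 \<inter> shadow f d F K e1 (E - {u}) = {}" using V1(3) V2(2) by blast
    then have "V2 \<inter> shadow f d F K e E = {}" using sub V2(3) by blast
    moreover have "V2 \<subseteq> W" using V1(2) V2(2) by blast
    moreover have "V2 \<in> \<Union>(\<V>2 ` \<V>1)" using V1(1) V2(1) by (rule UN_I)
    ultimately show ?thesis by (intro bexI[of _ V2] conjI)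
  qed
  moreover have "finite (\<Union>(\<V>2 ` \<V>1))" using \<V>1(1) \<V>2(1) by (rule finite_UN_I)
  moreover have "\<forall>V\<in>\<Union>(\<V>2 ` \<V>1). open V \<and> V \<noteq> {}" using \<V>2(2) by blast
  ultimately show ?case
    using e(1) by (intro exI[of _ e] conjI exI[of _ "\<Union>(\<V>2 ` \<V>1)"]) blast+
qed

text \<open>
  The radii \<open>\<epsilon>\<close> for which sharp measure zero is invoked are constructed from the meager set
  and \<open>K\<close>, together with finite families \<open>\<W> j\<close> of open sets: each member of \<open>\<W> j\<close> can be
  shrunk to a member of \<open>\<W> (Suc j)\<close> that avoids any \<open>3 ^ Suc j\<close> balls of radius \<open>\<epsilon> j\<close>.
\<close>
lemma sharp_measure_zero_imp_meager_additive_image: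
  fixes f :: "'a::topological_space \<Rightarrow> 'b::{topological_group_add, second_countable_topology}"
  assumes d: "Metric_space UNIV d" "Metric_space.mtopology UNIV d = euclidean"
    and f: "continuous_on UNIV f" and X: "sharp_measure_zero d X"
    and K: "\<And>n::nat. compact (K n)" "incseq K" "X \<subseteq> (\<Union>n. K n)"
  shows "meager_additive (f ` X)"
  unfolding meager_additive_def
proof (intro allI impI)
  fix M :: "'b set" assume "meager M"
  then obtain F :: "nat \<Rightarrow> 'b set"
    where F: "\<And>n. closed (F n)" "\<And>n. interior (F n) = {}" "incseq F" "M \<subseteq> (\<Union>n. F n)"
    by (rule meager_increasing_closed_cover) blast
  obtain \<B> :: "'b set set" where \<B>: "countable \<B>" "topological_basis \<B>"
    using ex_countable_basis by blast
  \<comment> \<open>Inserting \<^term>\<open>UNIV\<close> makes the family nonempty, so that \<^const>\<open>from_nat_into\<close> enumerates it.\<close>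
  define B where "B = from_nat_into (insert UNIV (\<B> - {{}}))"
  have B: "open (B i) \<and> B i \<noteq> {}" for i
    using from_nat_into[of "insert UNIV (\<B> - {{}})" i] topological_basis_open[OF \<B>(2)]
    by (auto simp: B_def)
  have B_dense: "\<exists>i. B i \<subseteq> W" if W: "open W" "W \<noteq> {}" for W
  proof -
    obtain w where "w \<in> W" using W(2) by blast
    then obtain B' where "B' \<in> \<B>" "w \<in> B'" "B' \<subseteq> W"
      using topological_basisE[OF \<B>(2) W(1)] by blast
    moreover have "countable (insert UNIV (\<B> - {{}}))" using \<B>(1) by simp
    ultimately show ?thesis
      using from_nat_into_surj[of "insert UNIV (\<B> - {{}})" B'] unfolding B_def by blast
  qed

  define P where "P j \<W> \<longleftrightarrow> finite \<W> \<and> (\<forall>W\<in>\<W>. open W \<and> W \<noteq> {}) \<and> B ` {..j} \<subseteq> \<W>" for j \<W>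
  define Q where "Q j \<W> \<W>' \<longleftrightarrow> (\<exists>e>0. \<forall>W\<in>\<W>. \<forall>E. finite E \<and> card E \<le> 3 ^ Suc j \<longrightarrow>
      (\<exists>V\<in>\<W>'. V \<subseteq> W \<and> V \<inter> shadow f d (F j) (K j) e E = {}))" for j \<W> \<W>'
  have "\<exists>\<W>. \<forall>j. P j (\<W> j) \<and> Q j (\<W> j) (\<W> (Suc j))"
  proof (rule dependent_nat_choice)
    show "\<exists>\<W>. P 0 \<W>"
      using B by (intro exI[of _ "{B 0}"]) (auto simp: P_def)
    fix \<W> j assume "P j \<W>"
    then have \<W>: "finite \<W>" "\<forall>W\<in>\<W>. open W \<and> W \<noteq> {}" by (auto simp: P_def)
    obtain e \<V> where e: "e > 0" and \<V>: "finite \<V>" "\<forall>V\<in>\<V>. open V \<and> V \<noteq> {}"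
      "\<forall>W\<in>\<W>. \<forall>E. finite E \<and> card E \<le> 3 ^ Suc j \<longrightarrow>
        (\<exists>V\<in>\<V>. V \<subseteq> W \<and> V \<inter> shadow f d (F j) (K j) e E = {})"
      using avoid_translates_uniformly[OF d f F(1)[of j] F(2)[of j] K(1)[of j] \<W>, where N = "3 ^ Suc j"]
      by - (elim exE conjE, rule that)
    have "P (Suc j) (\<V> \<union> B ` {..Suc j})"
      unfolding P_def using \<V>(1,2) B by auto
    moreover have "Q j \<W> (\<V> \<union> B ` {..Suc j})"
      unfolding Q_def using e \<V>(3) by (intro exI[of _ e] conjI) (assumption, meson UnI1)
    ultimately show "\<exists>\<W>'. P (Suc j) \<W>' \<and> Q j \<W> \<W>'" by blast
  qed
  then obtain \<W> where P: "\<And>j. P j (\<W> j)" and Q: "\<And>j. Q j (\<W> j) (\<W> (Suc j))" by blast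
  from Q obtain \<epsilon> where \<epsilon>: "\<And>j. \<epsilon> j > (0::real)"
    and stage: "\<And>j W E. W \<in> \<W> j \<Longrightarrow> finite E \<Longrightarrow> card E \<le> 3 ^ Suc j \<Longrightarrow>
      \<exists>V\<in>\<W> (Suc j). V \<subseteq> W \<and> V \<inter> shadow f d (F j) (K j) (\<epsilon> j) E = {}"
    unfolding Q_def by metis

  obtain E g where E: "\<And>j. finite (E j)" "\<And>j. card (E j) \<le> 3 ^ Suc j"
    and g: "\<And>x. x \<in> X \<Longrightarrow> \<forall>\<^sub>F n in sequentially. \<exists>j\<in>{n..<g n}. \<exists>u\<in>E j. d x u < \<epsilon> j"
    using X[unfolded sharp_measure_zero_def, rule_format, of \<epsilon>] \<epsilon> by blast
  have chain: "\<exists>V\<in>\<W> b. V \<subseteq> W \<and> (\<forall>j\<in>{a..<b}. V \<inter> shadow f d (F j) (K j) (\<epsilon> j) (E j) = {})"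
    if "a \<le> b" "W \<in> \<W> a" for a b W
    using that(1)
  proof (induction rule: dec_induct)
    case base
    then show ?case using that(2) by auto
  next
    case (step k)
    then obtain V where V: "V \<in> \<W> k" "V \<subseteq> W"
        "\<forall>j\<in>{a..<k}. V \<inter> shadow f d (F j) (K j) (\<epsilon> j) (E j) = {}" by blast
    obtain V' where V': "V' \<in> \<W> (Suc k)" "V' \<subseteq> V" "V' \<inter> shadow f d (F k) (K k) (\<epsilon> k) (E k) = {}"
      using stage[OF V(1) E] by blast
    have "V' \<inter> shadow f d (F j) (K j) (\<epsilon> j) (E j) = {}" if "j \<in> {a..<Suc k}" for j
    proof (cases "j = k")
      case False
      then have "j \<in> {a..<k}" using that by auto
      then have "V \<inter> shadow f d (F j) (K j) (\<epsilon> j) (E j) = {}" using V(3) by (rule bspec[rotated])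
      then show ?thesis using V'(2) by blast
    qed (simp add: V'(3))
    moreover have "V' \<subseteq> W" using V(2) V'(2) by (rule order_trans[rotated])
    ultimately show ?case using V'(1) by (intro bexI[of _ V'] conjI ballI)
  qed

  \<comment> \<open>A single index \<open>m\<close> controls the closed set, the compact set and the time from which
    points are caught; since \<open>F\<close> and \<open>K\<close> increase, stages \<open>j \<ge> m\<close> deal with \<open>F m\<close> and \<open>Y m\<close>.\<close>
  define Y where "Y m = {x \<in> K m. \<forall>n\<ge>m. \<exists>j\<in>{n..<g n}. \<exists>u\<in>E j. d x u < \<epsilon> j}" for m
  define N where "N m = {a + f x |a x. a \<in> F m \<and> x \<in> Y m}" for m
  have "nowhere_dense (N m)" for m
  proof (rule nowhere_dense_if_avoidable)
    fix W :: "'b set" assume "open W" "W \<noteq> {}"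
    then obtain i where i: "B i \<subseteq> W" using B_dense by blast
    define n where "n = max i m"
    \<comment> \<open>The maximum with \<open>n\<close> only covers the degenerate case \<open>g n < n\<close>.\<close>
    have "B i \<in> \<W> n" using P[of n] by (auto simp: P_def n_def)
    then obtain V where V: "V \<in> \<W> (max n (g n))" "V \<subseteq> B i"
        "\<forall>j\<in>{n..<max n (g n)}. V \<inter> shadow f d (F j) (K j) (\<epsilon> j) (E j) = {}"
      using chain[of n "max n (g n)" "B i"] by auto
    have "z \<notin> N m" if z: "z \<in> V" for z
    proof
      assume "z \<in> N m"
      then obtain a x where x: "z = a + f x" "a \<in> F m" "x \<in> Y m" unfolding N_def by blast
      moreover have "m \<le> n" by (simp add: n_def)
      ultimately obtain j u where j: "j \<in> {n..<g n}" "u \<in> E j" "d x u < \<epsilon> j"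
        unfolding Y_def by blast
      have "m \<le> j" using j(1) \<open>m \<le> n\<close> by simp
      then have "a \<in> F j" "x \<in> K j"
        using x F(3) K(2) unfolding Y_def incseq_def by blast+
      then have "z \<in> shadow f d (F j) (K j) (\<epsilon> j) (E j)"
        unfolding shadow_def using j x(1) by blast
      moreover have "j \<in> {n..<max n (g n)}" using j(1) by auto
      ultimately show False using V(3) z by blast
    qed
    moreover have "open V \<and> V \<noteq> {}" using P V(1) unfolding P_def by blast
    ultimately show "\<exists>V. open V \<and> V \<noteq> {} \<and> V \<subseteq> W \<and> V \<inter> N m = {}"
      using V(2) i by blast
  qed
  moreover have "{m + x |m x. m \<in> M \<and> x \<in> f ` X} \<subseteq> (\<Union>n. N n)"
  proof
    fix z assume "z \<in> {m + x |m x. m \<in> M \<and> x \<in> f ` X}"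
    then obtain a x where x: "z = a + f x" "a \<in> M" "x \<in> X" by blast
    obtain k1 where k1: "a \<in> F k1" using x(2) F(4) by blast
    obtain k2 where k2: "x \<in> K k2" using x(3) K(3) by blast
    obtain k3 where k3: "\<And>n. n \<ge> k3 \<Longrightarrow> \<exists>j\<in>{n..<g n}. \<exists>u\<in>E j. d x u < \<epsilon> j"
      using g[OF x(3)] unfolding eventually_sequentially by blast
    define m where "m = max k1 (max k2 k3)"
    have "k1 \<le> m" "k2 \<le> m" "k3 \<le> m" by (simp_all add: m_def)
    then have "a \<in> F m" "x \<in> K m"
      using k1 k2 incseqD[OF F(3), of k1 m] incseqD[OF K(2), of k2 m] by auto
    moreover have "x \<in> Y m"
      unfolding Y_def using \<open>x \<in> K m\<close> k3 by (auto simp: m_def)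
    ultimately show "z \<in> (\<Union>n. N n)" unfolding N_def using x(1) by blast
  qed
  ultimately show "meager {m + x |m x. m \<in> M \<and> x \<in> f ` X}"
    by (rule meager_subset_countable_Union)
qed

theorem theorem6p1:
  fixes f :: "'a::{topological_group_add, polish_space} \<Rightarrow> 'b::{topological_group_add, polish_space}"
    and X :: "'a set"
  assumes "\<exists>d :: 'a \<Rightarrow> 'a \<Rightarrow> real. invariant_metric d"
    and "locally_compact_space (euclidean :: 'b topology)"
    and "continuous_on UNIV f"
    and "meager_additive X"
  shows "meager_additive (f ` X)"
proof -
  obtain d :: "'a \<Rightarrow> 'a \<Rightarrow> real" where "invariant_metric d" using assms(1) by blast
  then interpret invariant_metric_group d by unfold_locales
  have X: "sharp_measure_zero d X"
    using assms(4) by (rule meager_additive_imp_sharp_measure_zero)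
  then obtain K :: "nat \<Rightarrow> 'a set"
    where K: "\<And>n. compact (K n)" "incseq K" "X \<subseteq> (\<Union>n. K n)"
    by (rule sharp_measure_zero_imp_sigma_compact) blast
  show ?thesis
    by (rule sharp_measure_zero_imp_meager_additive_image
        [OF Metric_space_axioms mtopology_eq assms(3) X K])
qed

end
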